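(* Let $\pi\in\mathfrak{B}_n$, write $d=\operatorname{des}^B(\pi)$, $e=\operatorname{ides}^B(\pi)$, and let $n(\pi)$ be the number of negative entries among $\pi_1,\dots,\pi_n$. Among the grid points $(i,j)$, $1\le i,j\le n+1$, of $P_\pi$, the number with $d^+$-type $(0,0)$, $(1,0)$, $(0,1)$, $(1,1)$ is respectively $(d+1)(e+1)-n(\pi)+n$, $(e+1)(n-d)+n(\pi)-n$, $(d+1)(n-e)+n(\pi)-n$, $(n-d)(n-e)-n(\pi)+n$; and the number with $d^-$-type $(0,0)$, $(1,0)$, $(0,1)$, $(1,1)$ is respectively $de+n(\pi)$, $e(n-d+1)-n(\pi)$, $d(n-e+1)-n(\pi)$, $(n-d+1)(n-e+1)+n(\pi)$.
   Context: $\mathfrak{B}_n$ is the set of signed permutations $\pi=\pi_1\cdots\pi_n$ ($\pi_i\in\{\pm1,\dots,\pm n\}$, $|\pi_1|,\dots,|\pi_n|$ a permutation of $[n]$), $\pi_0=0$, inverse given by $\pi^{-1}_{|\pi_i|}=\operatorname{sgn}(\pi_i)\,i$. Natural order: $\operatorname{des}^B(\pi)=|\{i\in\{0,\dots,n-1\}:\pi_i>\pi_{i+1}\}|$, $\operatorname{ides}^B(\pi)=\operatorname{des}^B(\pi^{-1})$. Grid points $(i,j)$, $1\le i,j\le n+1$, of the $n\times n$ grid $P_\pi$ are intersections of the $i$-th horizontal (from top) and $j$-th vertical (from left) grid lines. For $i,j\in[n+1]$, $\varphi_{(i,j)}(\pi)$ is the $\sigma\in\mathfrak{B}_{n+1}$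 with $\sigma_i=j$, $\sigma_k=s(\pi_k)$ for $k<i$, $\sigma_k=s(\pi_{k-1})$ for $k>i$, where $s(x)=x$ if $|x|<j$, $s(x)=x+1$ if $x\ge j$, $s(x)=x-1$ if $x\le-j$; $\overline{\varphi}_{(i,j)}(\pi)$ is the same with $\sigma_i=-j$. $d^+(i,j)=\big(\operatorname{des}^B(\varphi_{(i,j)}(\pi))-\operatorname{des}^B(\pi),\ \operatorname{ides}^B(\varphi_{(i,j)}(\pi))-\operatorname{ides}^B(\pi)\big)$, and $d^-(i,j)$ is the same with $\overline{\varphi}_{(i,j)}$. *)

theory Defs
  imports Complex_Main
begin

text \<open>
  A signed permutation of size n is encoded as a function on all of nat whose values at
  positions 1, ..., n are the entries of the word. It is 0 at every other position: at 0 this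
  is the convention for the zeroth entry, and beyond n it makes the encoding unique.
\<close>

definition signed_perms :: "nat \<Rightarrow> (nat \<Rightarrow> int) set" where
  "signed_perms n =
     {\<pi>. bij_betw (\<lambda>i. nat \<bar>\<pi> i\<bar>) {1..n} {1..n} \<and> (\<forall>i. i \<notin> {1..n} \<longrightarrow> \<pi> i = 0)}"

text \<open>Below, i is the position with \<open>\<bar>\<pi> i\<bar> = k\<close>.\<close>

definition sp_inv :: "nat \<Rightarrow> (nat \<Rightarrow> int) \<Rightarrow> (nat \<Rightarrow> int)" where
  "sp_inv n \<pi> k =
     (if k \<in> {1..n}
      then (let i = inv_into {1..n} (\<lambda>i. nat \<bar>\<pi> i\<bar>) k in sgn (\<pi> i) * int i)
      else 0)"

definition desB :: "nat \<Rightarrow> (nat \<Rightarrow> int) \<Rightarrow> nat" where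
  "desB n \<pi> = card {i \<in> {0..<n}. \<pi> i > \<pi> (i + 1)}"

definition idesB :: "nat \<Rightarrow> (nat \<Rightarrow> int) \<Rightarrow> nat" where
  "idesB n \<pi> = desB n (sp_inv n \<pi>)"

definition neg_count :: "nat \<Rightarrow> (nat \<Rightarrow> int) \<Rightarrow> nat" where
  "neg_count n \<pi> = card {i \<in> {1..n}. \<pi> i < 0}"

definition shift_entry :: "nat \<Rightarrow> int \<Rightarrow> int" where
  "shift_entry j x =
     (if \<bar>x\<bar> < int j then x else if x \<ge> int j then x + 1 else x - 1)"

text \<open>
  For \<open>i \<ge> 1\<close> and \<open>j \<ge> 1\<close> the two insertions preserve the value 0 at position 0 and beyond
  the end of the word, because \<open>shift_entry j 0 = 0\<close>.
\<close>

definition phi :: "nat \<times> nat \<Rightarrow> (nat \<Rightarrow> int) \<Rightarrow> (nat \<Rightarrow> int)" where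
  "phi = (\<lambda>(i, j) \<pi> k.
     if k < i then shift_entry j (\<pi> k)
     else if k = i then int j
     else shift_entry j (\<pi> (k - 1)))"

definition phi_bar :: "nat \<times> nat \<Rightarrow> (nat \<Rightarrow> int) \<Rightarrow> (nat \<Rightarrow> int)" where
  "phi_bar = (\<lambda>(i, j) \<pi> k.
     if k < i then shift_entry j (\<pi> k)
     else if k = i then - int j
     else shift_entry j (\<pi> (k - 1)))"

definition d_plus :: "nat \<Rightarrow> (nat \<Rightarrow> int) \<Rightarrow> nat \<times> nat \<Rightarrow> int \<times> int" where
  "d_plus n \<pi> p =
     (int (desB (n + 1) (phi p \<pi>)) - int (desB n \<pi>),
      int (idesB (n + 1) (phi p \<pi>)) - int (idesB n \<pi>))"

definition d_minus :: "nat \<Rightarrow> (nat \<Rightarrow> int) \<Rightarrow> nat \<times> nat \<Rightarrow> int \<times> int" where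
  "d_minus n \<pi> p =
     (int (desB (n + 1) (phi_bar p \<pi>)) - int (desB n \<pi>),
      int (idesB (n + 1) (phi_bar p \<pi>)) - int (idesB n \<pi>))"

definition grid_points :: "nat \<Rightarrow> (nat \<times> nat) set" where
  "grid_points n = {1..n + 1} \<times> {1..n + 1}"

end

theory Submission
  imports Defs
begin

text \<open>
  Append the entry \<open>n + 1\<close> to \<open>\<pi>\<close> and call the result \<open>\<Pi>\<close>, with inverse \<open>R\<close>. Inserting
  \<open>c j\<close> (with \<open>c = \<plusminus>1\<close>) at position \<open>i\<close> changes the descent number by
  \<open>u = 1 + c ([c \<Pi>(i-1) \<ge> j] - [c \<Pi>(i) \<ge> j]) - [\<Pi>(i-1) > \<Pi>(i)]\<close>, and since the inverse of the
  new word arises from \<open>\<pi>\<close>'s inverse by inserting \<open>c i\<close> at position \<open>j\<close>, the inverse descent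
  number changes by the analogous \<open>v\<close> in terms of \<open>R\<close>. Both are 0 or 1, so the four counts
  follow from the sums of \<open>u\<close>, \<open>v\<close> and \<open>u v\<close>. The sum of \<open>u\<close> over a column and that of \<open>v\<close> over
  a row telescope. In \<open>u v\<close> only the product of the two differences is not covered by this; its
  sum over a row telescopes up to an entry of \<open>\<Pi>\<close> and is 1 or 0 according to the sign of
  \<open>c \<Pi>(i)\<close>, which is how the number of negative entries appears.
\<close>

section \<open>Insertion and inversion of signed permutations\<close>

definition insert_entry :: "int \<Rightarrow> nat \<times> nat \<Rightarrow> (nat \<Rightarrow> int) \<Rightarrow> nat \<Rightarrow> int" where
  "insert_entry c = (\<lambda>(i, j) \<pi> k.
     if k < i then shift_entry j (\<pi> k)
     else if k = i then c * int j
     else shift_entry j (\<pi> (k - 1)))"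

lemma phi_eq_insert_entry: "phi = insert_entry 1"
  and phi_bar_eq_insert_entry: "phi_bar = insert_entry (- 1)"
  by (simp_all add: phi_def phi_bar_def insert_entry_def fun_eq_iff)

lemma signed_perms_outside: "\<pi> \<in> signed_perms n \<Longrightarrow> i \<notin> {1..n} \<Longrightarrow> \<pi> i = 0"
  by (simp add: signed_perms_def)

lemma signed_perms_abs:
  assumes "\<pi> \<in> signed_perms n" "i \<in> {1..n}"
  shows "nat \<bar>\<pi> i\<bar> \<in> {1..n}"
  using assms bij_betwE unfolding signed_perms_def by fastforce

lemma signed_perms_abs_le:
  assumes "\<pi> \<in> signed_perms n"
  shows "\<bar>\<pi> i\<bar> \<le> int n"
  using signed_perms_abs[OF assms, of i] signed_perms_outside[OF assms, of i]
  by (cases "i \<in> {1..n}") auto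

lemma signed_perms_nonzero:
  assumes "\<pi> \<in> signed_perms n" "i \<in> {1..n}"
  shows "\<pi> i \<noteq> 0"
  using signed_perms_abs[OF assms] by auto

lemma sp_inv_abs:
  assumes "\<pi> \<in> signed_perms n" "i \<in> {1..n}"
  shows "sp_inv n \<pi> (nat \<bar>\<pi> i\<bar>) = sgn (\<pi> i) * int i"
proof -
  have "inj_on (\<lambda>i. nat \<bar>\<pi> i\<bar>) {1..n}"
    using assms(1) by (simp add: signed_perms_def bij_betw_def)
  from inv_into_f_f[OF this assms(2)]
  have "inv_into {1..n} (\<lambda>i. nat \<bar>\<pi> i\<bar>) (nat \<bar>\<pi> i\<bar>) = i" by simp
  then show ?thesis
    using signed_perms_abs[OF assms] unfolding sp_inv_def by (simp add: Let_def)
qed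

lemma sp_inv_outside: "k \<notin> {1..n} \<Longrightarrow> sp_inv n \<pi> k = 0"
  by (auto simp: sp_inv_def)

text \<open>Since \<open>\<rho>\<close> returns the position of every entry up to sign,
  \<open>\<sigma>\<close> is injective in absolute value, and finiteness gives surjectivity.
  Checking one composition thus yields both membership and the inverse.\<close>

lemma sp_inv_eqI:
  assumes out: "\<And>i. i \<notin> {1..n} \<Longrightarrow> \<sigma> i = 0" "\<And>i. i \<notin> {1..n} \<Longrightarrow> \<rho> i = 0"
    and ran: "\<And>i. i \<in> {1..n} \<Longrightarrow> nat \<bar>\<sigma> i\<bar> \<in> {1..n}"
    and inv: "\<And>i. i \<in> {1..n} \<Longrightarrow> \<rho> (nat \<bar>\<sigma> i\<bar>) = sgn (\<sigma> i) * int i"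
  shows "\<sigma> \<in> signed_perms n" "sp_inv n \<sigma> = \<rho>"
proof -
  have *: "\<bar>\<rho> (nat \<bar>\<sigma> i\<bar>)\<bar> = int i" if "i \<in> {1..n}" for i
    using ran[OF that] inv[OF that] by (auto simp: abs_mult sgn_if)
  have inj: "inj_on (\<lambda>i. nat \<bar>\<sigma> i\<bar>) {1..n}"
    by (rule inj_onI) (metis * of_nat_eq_iff)
  have im: "(\<lambda>i. nat \<bar>\<sigma> i\<bar>) ` {1..n} = {1..n}"
    by (rule endo_inj_surj) (use inj ran in auto)
  show sp: "\<sigma> \<in> signed_perms n"
    using inj im out by (auto simp: signed_perms_def bij_betw_def)
  show "sp_inv n \<sigma> = \<rho>"
  proof
    fix k
    show "sp_inv n \<sigma> k = \<rho> k"
    proof (cases "k \<in> {1..n}")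
      case True
      then obtain i where "i \<in> {1..n}" "k = nat \<bar>\<sigma> i\<bar>" using im by blast
      then show ?thesis using sp_inv_abs[OF sp] inv by simp
    qed (simp add: sp_inv_outside out)
  qed
qed

lemma sp_inv_in_signed_perms:
  assumes "\<pi> \<in> signed_perms n"
  shows "sp_inv n \<pi> \<in> signed_perms n"
\<comment> \<open>Here \<open>\<pi>\<close> serves as the inverse of its own inverse.\<close>
proof (rule sp_inv_eqI(1)[where \<rho> = \<pi>])
  have surj: "(\<lambda>i. nat \<bar>\<pi> i\<bar>) ` {1..n} = {1..n}"
    using assms by (simp add: signed_perms_def bij_betw_def)
  fix k assume "k \<in> {1..n}"
  then obtain i where i: "i \<in> {1..n}" "k = nat \<bar>\<pi> i\<bar>" using surj by blast
  have "\<pi> i \<noteq> 0" by (rule signed_perms_nonzero[OF assms i(1)])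
  with i show "nat \<bar>sp_inv n \<pi> k\<bar> \<in> {1..n}"
    and "\<pi> (nat \<bar>sp_inv n \<pi> k\<bar>) = sgn (sp_inv n \<pi> k) * int k"
    using sp_inv_abs[OF assms i(1)] by (auto simp: abs_mult sgn_if)
qed (use signed_perms_outside[OF assms] sp_inv_outside in auto)

text \<open>Inversion transposes the grid and keeps signs. Positions and values exchange roles, so
  shifting values from \<open>j\<close> on becomes shifting positions from \<open>j\<close>
  on.\<close>

lemma insert_entry_inverse:
  assumes sp: "\<pi> \<in> signed_perms n" and c: "c = 1 \<or> c = - 1"
    and i: "i \<in> {1..n + 1}" and j: "j \<in> {1..n + 1}"
  shows "insert_entry c (i, j) \<pi> \<in> signed_perms (n + 1)"
    and "sp_inv (n + 1) (insert_entry c (i, j) \<pi>) = insert_entry c (j, i) (sp_inv n \<pi>)"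
proof -
  let ?\<sigma> = "insert_entry c (i, j) \<pi>" and ?\<rho> = "insert_entry c (j, i) (sp_inv n \<pi>)"
  have old: "nat \<bar>shift_entry j (\<pi> k)\<bar> \<in> {1..n + 1} \<and>
      ?\<rho> (nat \<bar>shift_entry j (\<pi> k)\<bar>) = sgn (shift_entry j (\<pi> k)) * int (if k < i then k else k + 1)"
    if "k \<in> {1..n}" for k
  proof -
    define v where "v = nat \<bar>\<pi> k\<bar>"
    have v: "v \<in> {1..n}" "\<bar>\<pi> k\<bar> = int v" "\<pi> k \<noteq> 0"
      using signed_perms_abs[OF sp that] signed_perms_nonzero[OF sp that] by (auto simp: v_def)
    have inv: "sp_inv n \<pi> v = sgn (\<pi> k) * int k"
      using sp_inv_abs[OF sp that] by (simp add: v_def)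
    have sgn: "sgn (shift_entry j (\<pi> k)) = sgn (\<pi> k)"
      using v j by (auto simp: shift_entry_def sgn_if)
    have abs: "nat \<bar>shift_entry j (\<pi> k)\<bar> = (if v < j then v else v + 1)"
      using v j by (auto simp: shift_entry_def)
    \<comment> \<open>This position is never \<open>j\<close>, so an old entry of the inverse is
      read off.\<close>
    have "?\<rho> (if v < j then v else v + 1) = shift_entry i (sp_inv n \<pi> v)"
      by (auto simp: insert_entry_def)
    also have "\<dots> = sgn (\<pi> k) * int (if k < i then k else k + 1)"
      using v(3) i that by (auto simp: inv shift_entry_def sgn_if)
    finally show ?thesis using v(1) by (auto simp: abs sgn)
  qed
  have new: "nat \<bar>?\<sigma> k\<bar> \<in> {1..n + 1} \<and> ?\<rho> (nat \<bar>?\<sigma> k\<bar>) = sgn (?\<sigma> k) * int k"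
    if "k \<in> {1..n + 1}" for k
  proof -
    consider "k < i" | "k = i" | "k > i" by linarith
    then show ?thesis
    proof cases
      case 1
      with i that old[of k] show ?thesis by (auto simp: insert_entry_def)
    next
      case 2
      with i j c show ?thesis by (auto simp: insert_entry_def)
    next
      case 3
      with i that have "k - 1 \<in> {1..n}" by auto
      from old[OF this] 3 show ?thesis by (auto simp: insert_entry_def)
    qed
  qed
  have out: "insert_entry c (i', j') \<tau> k = 0"
    if \<tau>: "\<And>k. k \<notin> {1..n} \<Longrightarrow> \<tau> k = 0" and "i' \<in> {1..n + 1}" "j' \<in> {1..n + 1}" "k \<notin> {1..n + 1}"
    for i' j' k \<tau>
  proof -
    have "\<tau> k = 0" "k > 0 \<Longrightarrow> \<tau> (k - 1) = 0" using that by (auto intro!: \<tau>)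
    with that show ?thesis by (auto simp: insert_entry_def shift_entry_def)
  qed
  have outs: "?\<sigma> k = 0" "?\<rho> k = 0" if "k \<notin> {1..n + 1}" for k
    using that out[of \<pi> i j k] out[of "sp_inv n \<pi>" j i k] i j signed_perms_outside[OF sp] sp_inv_outside
    by blast+
  show "?\<sigma> \<in> signed_perms (n + 1)" "sp_inv (n + 1) ?\<sigma> = ?\<rho>"
    by (rule sp_inv_eqI[of "n + 1" ?\<sigma> ?\<rho>, OF outs]; use new in blast)+
qed

section \<open>Effect of one insertion on the descent number\<close>

lemma int_desB: "int (desB n \<pi>) = (\<Sum>k<n. of_bool (\<pi> k > \<pi> (Suc k)))"
proof -
  have "{..<n} \<inter> {k. \<pi> k > \<pi> (Suc k)} = {i \<in> {0..<n}. \<pi> i > \<pi> (i + 1)}" by auto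
  then show ?thesis by (simp add: desB_def)
qed

lemma shift_entry_less_iff: "shift_entry j x < shift_entry j y \<longleftrightarrow> x < y"
  by (auto simp: shift_entry_def)

text \<open>The extension by a largest final entry lets the last grid line obey the same formula
  as the others.\<close>

lemma desB_insert_entry:
  assumes c: "c = 1 \<or> c = - 1" and a: "a \<le> n" and b: "b \<le> n"
    and bd: "\<And>k. \<bar>\<pi> k\<bar> \<le> int n"
    and ext: "\<Pi> = \<pi>(Suc n := int (Suc n))"
  shows "int (desB (n + 1) (insert_entry c (Suc a, Suc b) \<pi>)) - int (desB n \<pi>) =
    1 + c * (of_bool (int b < c * \<Pi> a) - of_bool (int b < c * \<Pi> (Suc a)))
      - of_bool (\<Pi> a > \<Pi> (Suc a))"
proof -
  define \<sigma> where "\<sigma> = insert_entry c (Suc a, Suc b) \<pi>"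
  let ?D = "\<lambda>\<tau> m. (\<Sum>k<m. of_bool (\<tau> k > \<tau> (Suc k)) :: int)"
  let ?s = "shift_entry (Suc b)"
  have lt: "\<sigma> k = ?s (\<pi> k)" if "k \<le> a" for k
    using that by (simp add: \<sigma>_def insert_entry_def)
  have eq: "\<sigma> (Suc a) = c * int (Suc b)"
    by (simp add: \<sigma>_def insert_entry_def)
  have gt: "\<sigma> (Suc k) = ?s (\<pi> k)" if "a < k" for k
    using that by (simp add: \<sigma>_def insert_entry_def)
  have "?D \<sigma> a = ?D \<pi> a"
    by (rule sum.cong) (auto simp: lt shift_entry_less_iff)
  then have base: "?D \<sigma> (Suc a) = ?D \<pi> a + of_bool (?s (\<pi> a) > c * int (Suc b))"
    by (simp add: lt eq)
  \<comment> \<open>The comparison of positions \<open>a\<close> and \<open>Suc a\<close> gives way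
    to two comparisons with the new entry. All later ones only move one place, so the difference
    does not depend on \<open>m\<close>.\<close>
  have step: "?D \<sigma> (Suc m) - ?D \<pi> m = of_bool (?s (\<pi> a) > c * int (Suc b))
      + of_bool (c * int (Suc b) > ?s (\<pi> (Suc a))) - of_bool (\<pi> a > \<pi> (Suc a))"
    if "Suc a \<le> m" for m
    using that
  proof (induction m rule: dec_induct)
    case base
    show ?case using \<open>?D \<sigma> (Suc a) = _\<close> by (simp add: eq gt)
  next
    case (step m)
    then show ?case by (simp add: gt shift_entry_less_iff)
  qed
  \<comment> \<open>The shift skips the values \<open>Suc b\<close> and \<open>- Suc b\<close>, so
    an old entry never ties with the new one.\<close>
  have key: "?s x > c * int (Suc b) \<longleftrightarrow> (if c = 1 then int b < c * x else \<not> int b < c * x)"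
    "c * int (Suc b) > ?s x \<longleftrightarrow> (if c = 1 then \<not> int b < c * x else int b < c * x)" for x
    using c by (auto simp: shift_entry_def)
  have "?D \<sigma> (Suc n) - ?D \<pi> n =
    1 + c * (of_bool (int b < c * \<Pi> a) - of_bool (int b < c * \<Pi> (Suc a)))
      - of_bool (\<Pi> a > \<Pi> (Suc a))"
  proof (cases "a = n")
    \<comment> \<open>Only one new comparison arises here. To match it,
      \<open>\<Pi> (Suc n) = n + 1\<close> passes the threshold exactly for \<open>c = 1\<close> and
      makes no descent after \<open>\<Pi> n\<close>.\<close>
    case True
    with base[unfolded key] b c bd[of n] show ?thesis by (auto simp: ext simp del: sum_of_bool_eq)
  next
    case False
    with a have "Suc a \<le> n" by simp
    with step[OF this, unfolded key] c show ?thesis by (auto simp: ext simp del: sum_of_bool_eq sum.lessThan_Suc)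
  qed
  then show ?thesis by (simp add: int_desB flip: \<sigma>_def)
qed

section \<open>Telescoping sums over the grid\<close>

text \<open>The indicator cuts the sum off at \<open>nat z\<close>, which the bound keeps within the
  range of summation.\<close>

lemma sum_threshold_telescope:
  fixes f :: "nat \<Rightarrow> int"
  assumes "z \<le> int m"
  shows "(\<Sum>b<m. of_bool (int b < z) * (f b - f (Suc b))) = (if z > 0 then f 0 - f (nat z) else 0)"
proof -
  have "(\<Sum>b<m. of_bool (int b < z) * (f b - f (Suc b))) = (\<Sum>b<nat z. f b - f (Suc b))"
    using assms by (intro sum.mono_neutral_cong_right) auto
  then show ?thesis by (auto simp: sum_lessThan_telescope')
qed

text \<open>In row \<open>a\<close> the sum over \<open>b\<close> telescopes, and what remains compares \<open>a\<close> with the position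
  of the entry at which the threshold stops.\<close>

lemma sum_exchange:
  assumes sp: "\<Pi> \<in> signed_perms M" and c: "c = 1 \<or> c = - 1" and R: "R = sp_inv M \<Pi>"
  shows "(\<Sum>a<M. \<Sum>b<M. (of_bool (int b < c * \<Pi> a) - of_bool (int b < c * \<Pi> (Suc a))) *
      (of_bool (int a < c * R b) - of_bool (int a < c * R (Suc b)) :: int)) =
    (\<Sum>a<M. of_bool (c * \<Pi> (Suc a) > 0))"
proof (rule sum.cong[OF refl])
  fix a assume "a \<in> {..<M}"
  let ?f = "\<lambda>b. of_bool (int a < c * R b) :: int"
  have row: "(\<Sum>b<M. of_bool (int b < c * \<Pi> k) * (?f b - ?f (Suc b))) =
      - of_bool (c * \<Pi> k > 0 \<and> a < k)" if "k \<le> M" for k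
  proof -
    have "c * \<Pi> k \<le> int M" using signed_perms_abs_le[OF sp, of k] c by auto
    moreover have "?f 0 = 0" by (simp add: R sp_inv_outside)
    \<comment> \<open>Positivity says that \<open>\<Pi> k\<close> has sign \<open>c\<close>, so
      \<open>nat (c * \<Pi> k)\<close> is its absolute value, where \<open>R\<close> takes the value
      \<open>c * k\<close>.\<close>
    moreover have "c * R (nat (c * \<Pi> k)) = int k" if pos: "c * \<Pi> k > 0"
    proof -
      have "\<Pi> k \<noteq> 0" using pos by auto
      then have "k \<in> {1..M}" using signed_perms_outside[OF sp] by blast
      from sp_inv_abs[OF sp this] pos c show ?thesis by (auto simp: R sgn_if)
    qed
    ultimately show ?thesis using sum_threshold_telescope[of "c * \<Pi> k" M ?f] by auto
  qed
  have "(\<Sum>b<M. (of_bool (int b < c * \<Pi> a) - of_bool (int b < c * \<Pi> (Suc a))) * (?f b - ?f (Suc b)))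
      = (\<Sum>b<M. of_bool (int b < c * \<Pi> a) * (?f b - ?f (Suc b)))
      - (\<Sum>b<M. of_bool (int b < c * \<Pi> (Suc a)) * (?f b - ?f (Suc b)))"
    by (simp add: left_diff_distrib sum_subtractf)
  also have "\<dots> = of_bool (c * \<Pi> (Suc a) > 0)"
  proof -
    \<comment> \<open>The condition \<open>a < k\<close> fails for \<open>k = a\<close> and holds
      for \<open>k = Suc a\<close>, so only the entry \<open>\<Pi> (Suc a)\<close>
      contributes.\<close>
    have "a \<le> M" "Suc a \<le> M" using \<open>a \<in> {..<M}\<close> by auto
    then show ?thesis unfolding row[OF \<open>a \<le> M\<close>] row[OF \<open>Suc a \<le> M\<close>] by simp
  qed
  finally show "(\<Sum>b<M. (of_bool (int b < c * \<Pi> a) - of_bool (int b < c * \<Pi> (Suc a))) * (?f b - ?f (Suc b)))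
    = of_bool (c * \<Pi> (Suc a) > 0)" .
qed

text \<open>The algebra, freed from permutations: \<open>x\<close> and \<open>y\<close> stand for
  threshold indicators, \<open>D\<close> and \<open>E\<close> for descent indicators, and
  \<open>\<beta>\<close> for the boundary value that telescoping leaves.\<close>

lemma sum_two_way:
  fixes x y :: "nat \<Rightarrow> nat \<Rightarrow> int" and D E :: "nat \<Rightarrow> int" and c \<beta> :: int
  assumes c: "c * c = 1" and d: "sum D {..<M} = d" and e: "sum E {..<M} = e"
    and x: "\<And>b. b < M \<Longrightarrow> x 0 b = 0" "\<And>b. b < M \<Longrightarrow> c * x M b = \<beta>"
    and y: "\<And>a. a < M \<Longrightarrow> y a 0 = 0" "\<And>a. a < M \<Longrightarrow> c * y a M = \<beta>"
    and xy: "(\<Sum>a<M. \<Sum>b<M. (x a b - x (Suc a) b) * (y a b - y a (Suc b))) = t"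
    and u: "\<And>a b. u a b = 1 + c * (x a b - x (Suc a) b) - D a"
    and v: "\<And>a b. v a b = 1 + c * (y a b - y a (Suc b)) - E b"
  shows "(\<Sum>a<M. \<Sum>b<M. u a b) = int M * (int M - \<beta> - d)"
    and "(\<Sum>a<M. \<Sum>b<M. v a b) = int M * (int M - \<beta> - e)"
    and "(\<Sum>a<M. \<Sum>b<M. u a b * v a b) = (int M - e) * (int M - \<beta> - d) - \<beta> * (int M - d) + t"
proof -
  have dx: "(\<Sum>a<M. c * (x a b - x (Suc a) b)) = - \<beta>" if "b < M" for b
    unfolding sum_distrib_left[symmetric] sum_lessThan_telescope'[of "\<lambda>a. x a b"]
    using x[OF that] by (simp add: right_diff_distrib)
  have dy: "(\<Sum>b<M. c * (y a b - y a (Suc b))) = - \<beta>" if "a < M" for a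
    unfolding sum_distrib_left[symmetric] sum_lessThan_telescope'[of "\<lambda>b. y a b"]
    using y[OF that] by (simp add: right_diff_distrib)
  have su: "(\<Sum>a<M. u a b) = int M - \<beta> - d" if "b < M" for b
    using dx[OF that] d by (simp add: u sum.distrib sum_subtractf)
  have sv: "(\<Sum>b<M. v a b) = int M - \<beta> - e" if "a < M" for a
    using dy[OF that] e by (simp add: v sum.distrib sum_subtractf)
  show "(\<Sum>a<M. \<Sum>b<M. u a b) = int M * (int M - \<beta> - d)"
    by (subst sum.swap) (simp add: su)
  show "(\<Sum>a<M. \<Sum>b<M. v a b) = int M * (int M - \<beta> - e)"
    by (simp add: sv)
  \<comment> \<open>Keeping \<open>u\<close> whole in the first term isolates the product of
    differences. The first double sum is evaluated over \<open>a\<close> first, the second over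
    \<open>b\<close> first.\<close>
  have "(\<Sum>a<M. \<Sum>b<M. u a b * v a b) =
    (\<Sum>a<M. \<Sum>b<M. (1 - E b) * u a b) + (\<Sum>a<M. \<Sum>b<M. (1 - D a) * (c * (y a b - y a (Suc b))))
    + (\<Sum>a<M. \<Sum>b<M. (x a b - x (Suc a) b) * (y a b - y a (Suc b)))"
    unfolding sum.distrib[symmetric]
  proof (intro sum.cong refl)
    fix a b
    have "u a b * v a b = (1 - E b) * u a b + (1 - D a) * (c * (y a b - y a (Suc b)))
        + (c * c) * ((x a b - x (Suc a) b) * (y a b - y a (Suc b)))"
      by (simp add: u v algebra_simps)
    then show "u a b * v a b = (1 - E b) * u a b + (1 - D a) * (c * (y a b - y a (Suc b)))
        + (x a b - x (Suc a) b) * (y a b - y a (Suc b))"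
      by (simp add: c)
  qed
  moreover have "(\<Sum>a<M. \<Sum>b<M. (1 - E b) * u a b) = (\<Sum>b<M. (1 - E b) * (int M - \<beta> - d))"
    by (subst sum.swap) (simp add: su flip: sum_distrib_left)
  moreover have "(\<Sum>a<M. \<Sum>b<M. (1 - D a) * (c * (y a b - y a (Suc b)))) = (\<Sum>a<M. (1 - D a) * - \<beta>)"
    by (intro sum.cong refl, subst sum_distrib_left[symmetric]) (simp add: dy)
  moreover have "(\<Sum>b<M. (1 - E b) * (int M - \<beta> - d)) = (int M - e) * (int M - \<beta> - d)"
    by (simp add: sum_subtractf e flip: sum_distrib_right)
  moreover have "(\<Sum>a<M. (1 - D a) * - \<beta>) = - \<beta> * (int M - d)"
    unfolding sum_distrib_right[symmetric] by (simp add: sum_subtractf d)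
  ultimately show "(\<Sum>a<M. \<Sum>b<M. u a b * v a b) =
      (int M - e) * (int M - \<beta> - d) - \<beta> * (int M - d) + t"
    by (simp add: xy)
qed

section \<open>From sums to counts of types\<close>

lemma sum_grid_points: "sum f (grid_points n) = (\<Sum>a<n + 1. \<Sum>b<n + 1. f (Suc a, Suc b))"
  unfolding grid_points_def sum.cartesian_product' One_nat_def sum.atLeast1_atMost_eq ..

text \<open>For values 0 and 1 the indicators of the types are (1 - U)(1 - V), U(1 - V), V(1 - U)
  and UV.\<close>

lemma card_by_types:
  fixes U V :: "'a \<Rightarrow> int"
  assumes "finite G" and U: "\<And>p. p \<in> G \<Longrightarrow> U p = 0 \<or> U p = 1"
    and V: "\<And>p. p \<in> G \<Longrightarrow> V p = 0 \<or> V p = 1"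
  shows "int (card {p \<in> G. (U p, V p) = (0, 0)}) = int (card G) - sum U G - sum V G + (\<Sum>p\<in>G. U p * V p)"
    and "int (card {p \<in> G. (U p, V p) = (1, 0)}) = sum U G - (\<Sum>p\<in>G. U p * V p)"
    and "int (card {p \<in> G. (U p, V p) = (0, 1)}) = sum V G - (\<Sum>p\<in>G. U p * V p)"
    and "int (card {p \<in> G. (U p, V p) = (1, 1)}) = (\<Sum>p\<in>G. U p * V p)"
proof -
  have card: "int (card {p \<in> G. P p}) = (\<Sum>p\<in>G. of_bool (P p))" for P
    using assms(1) by (simp add: Collect_conj_eq)
  have "(\<Sum>p\<in>G. of_bool ((U p, V p) = (0, 0))) = (\<Sum>p\<in>G. 1 - U p - V p + U p * V p)"
    "(\<Sum>p\<in>G. of_bool ((U p, V p) = (1, 0))) = (\<Sum>p\<in>G. U p - U p * V p)"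
    "(\<Sum>p\<in>G. of_bool ((U p, V p) = (0, 1))) = (\<Sum>p\<in>G. V p - U p * V p)"
    "(\<Sum>p\<in>G. of_bool ((U p, V p) = (1, 1))) = (\<Sum>p\<in>G. U p * V p)"
    using U V by (intro sum.cong refl; fastforce)+
  then show "int (card {p \<in> G. (U p, V p) = (0, 0)}) = int (card G) - sum U G - sum V G + (\<Sum>p\<in>G. U p * V p)"
    and "int (card {p \<in> G. (U p, V p) = (1, 0)}) = sum U G - (\<Sum>p\<in>G. U p * V p)"
    and "int (card {p \<in> G. (U p, V p) = (0, 1)}) = sum V G - (\<Sum>p\<in>G. U p * V p)"
    and "int (card {p \<in> G. (U p, V p) = (1, 1)}) = (\<Sum>p\<in>G. U p * V p)"
    unfolding card by (simp_all add: sum.distrib sum_subtractf)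
qed

text \<open>Both signs are handled at once. \<open>\<beta>\<close> is \<open>c\<close> times the
  threshold indicator of the appended entry, \<open>t\<close> counts the entries of
  \<open>\<Pi>\<close> with sign \<open>c\<close> (the appended one included if
  \<open>c = 1\<close>), and \<open>q\<close> is the sum of \<open>u v\<close>.\<close>

lemma insert_entry_type_counts:
  fixes n :: nat and \<pi> :: "nat \<Rightarrow> int" and c d e m N \<beta> t q :: int
  assumes sp: "\<pi> \<in> signed_perms n" and c: "c = 1 \<or> c = - 1"
    and d_def: "d = int (desB n \<pi>)" and e_def: "e = int (idesB n \<pi>)"
    and m_def: "m = int (neg_count n \<pi>)" and N_def: "N = int n"
    and T_def: "T = (\<lambda>p. (int (desB (n + 1) (insert_entry c p \<pi>)) - int (desB n \<pi>),
      int (idesB (n + 1) (insert_entry c p \<pi>)) - int (idesB n \<pi>)))"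
    and \<beta>_def: "\<beta> = of_bool (c = 1)" and t_def: "t = (if c = 1 then N + 1 - m else m)"
    and q_def: "q = (N + 1 - e) * (N + 1 - \<beta> - d) - \<beta> * (N + 1 - d) + t"
  shows "int (card {p \<in> grid_points n. T p = (1, 1)}) = q"
    and "int (card {p \<in> grid_points n. T p = (1, 0)}) = (N + 1) * (N + 1 - \<beta> - d) - q"
    and "int (card {p \<in> grid_points n. T p = (0, 1)}) = (N + 1) * (N + 1 - \<beta> - e) - q"
    and "int (card {p \<in> grid_points n. T p = (0, 0)}) =
      (N + 1) * (N + 1) - (N + 1) * (N + 1 - \<beta> - d) - (N + 1) * (N + 1 - \<beta> - e) + q"
proof -
  define \<rho> where "\<rho> = sp_inv n \<pi>"
  have sp': "\<rho> \<in> signed_perms n" using sp by (simp add: \<rho>_def sp_inv_in_signed_perms)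
  define \<Pi> where "\<Pi> = \<pi>(Suc n := int (Suc n))"
  define R where "R = \<rho>(Suc n := int (Suc n))"
  \<comment> \<open>Appending \<open>n + 1\<close> is itself an insertion, at the corner of the
    grid, and shifts no old entry; hence it commutes with inversion.\<close>
  have ext: "\<tau>(Suc n := int (Suc n)) = insert_entry 1 (n + 1, n + 1) \<tau>" if "\<tau> \<in> signed_perms n" for \<tau>
  proof
    fix k
    have "\<tau> k = 0" if "k > n" for k using that signed_perms_outside[OF \<open>\<tau> \<in> _\<close>] by auto
    with signed_perms_abs_le[OF that, of k] signed_perms_abs_le[OF that, of "k - 1"]
    show "(\<tau>(Suc n := int (Suc n))) k = insert_entry 1 (n + 1, n + 1) \<tau> k"
      by (auto simp: insert_entry_def shift_entry_def)
  qed
  have SP: "\<Pi> \<in> signed_perms (n + 1)" and R: "R = sp_inv (n + 1) \<Pi>"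
    using insert_entry_inverse[OF sp, of 1 "n + 1" "n + 1"] ext[OF sp] ext[OF sp']
    by (simp_all add: \<Pi>_def R_def \<rho>_def)
  define x :: "nat \<Rightarrow> nat \<Rightarrow> int" where "x = (\<lambda>a b. of_bool (int b < c * \<Pi> a))"
  define y :: "nat \<Rightarrow> nat \<Rightarrow> int" where "y = (\<lambda>a b. of_bool (int a < c * R b))"
  define u where "u = (\<lambda>a b. 1 + c * (x a b - x (Suc a) b) - of_bool (\<Pi> a > \<Pi> (Suc a)))"
  define v where "v = (\<lambda>a b. 1 + c * (y a b - y a (Suc b)) - of_bool (R b > R (Suc b)))"
  have T: "T (Suc a, Suc b) = (u a b, v a b)" if "a \<le> n" "b \<le> n" for a b
  proof -
    \<comment> \<open>By transposition, the descent formula for \<open>\<rho>\<close> also gives the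
      second coordinate.\<close>
    have "idesB (n + 1) (insert_entry c (Suc a, Suc b) \<pi>) = desB (n + 1) (insert_entry c (Suc b, Suc a) \<rho>)"
      using insert_entry_inverse(2)[OF sp c, of "Suc a" "Suc b"] that by (simp add: idesB_def \<rho>_def)
    then show ?thesis
      using desB_insert_entry[OF c that signed_perms_abs_le[OF sp] \<Pi>_def]
        desB_insert_entry[OF c that(2,1) signed_perms_abs_le[OF sp'] R_def]
      by (simp add: T_def u_def v_def x_def y_def idesB_def \<rho>_def)
  qed
  \<comment> \<open>Thresholds are monotone: at a descent the difference times \<open>c\<close> is 0
    or 1, elsewhere it is 0 or -1.\<close>
  have u01: "u a b = 0 \<or> u a b = 1" and v01: "v a b = 0 \<or> v a b = 1" for a b
    using c by (auto simp: u_def v_def x_def y_def)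
  have last: "\<tau> n < int n + 1" "\<tau> 0 = 0" if "\<tau> \<in> signed_perms n" for \<tau>
    using signed_perms_abs_le[OF that, of n] signed_perms_outside[OF that] by auto
  \<comment> \<open>The comparison with the appended entry adds no descent.\<close>
  have d: "(\<Sum>a<n + 1. of_bool (\<Pi> a > \<Pi> (Suc a))) = d"
    using last[OF sp] by (simp add: d_def \<Pi>_def int_desB)
  have e: "(\<Sum>a<n + 1. of_bool (R a > R (Suc a))) = e"
    using last[OF sp'] by (simp add: e_def R_def idesB_def int_desB flip: \<rho>_def)
  have neg: "(\<Sum>a<n. of_bool (\<pi> (Suc a) < 0)) = m"
  proof -
    have "m = (\<Sum>a\<in>{1..n}. of_bool (\<pi> a < 0))"
      by (simp add: m_def neg_count_def Int_def del: atLeastAtMost_iff)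
    then show ?thesis unfolding One_nat_def sum.atLeast1_atMost_eq by simp
  qed
  have t: "(\<Sum>a<n + 1. of_bool (c * \<Pi> (Suc a) > 0)) = t"
  proof (cases "c = 1")
    case True
    have "(\<Sum>a<n. of_bool (\<pi> (Suc a) > 0)) = (\<Sum>a<n. 1 - of_bool (\<pi> (Suc a) < 0) :: int)"
    proof (rule sum.cong[OF refl])
      fix a assume "a \<in> {..<n}"
      then have "\<pi> (Suc a) \<noteq> 0" by (intro signed_perms_nonzero[OF sp]) auto
      then show "of_bool (\<pi> (Suc a) > 0) = 1 - (of_bool (\<pi> (Suc a) < 0) :: int)" by auto
    qed
    with True neg show ?thesis by (simp add: t_def \<Pi>_def N_def sum_subtractf)
  next
    case False
    with c neg show ?thesis by (simp add: t_def \<Pi>_def)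
  qed
  have cc: "c * c = 1" using c by auto
  \<comment> \<open>The entry 0 at position 0 passes no threshold; the appended entry passes all of
    them for \<open>c = 1\<close> and none for \<open>c = - 1\<close>.\<close>
  have bdry: "x 0 b = 0" "c * x (n + 1) b = \<beta>" "y b 0 = 0" "c * y b (n + 1) = \<beta>" if "b < n + 1" for b
    using that c last(2)[OF sp] last(2)[OF sp'] by (auto simp: x_def y_def \<beta>_def \<Pi>_def R_def)
  have xy: "(\<Sum>a<n + 1. \<Sum>b<n + 1. (x a b - x (Suc a) b) * (y a b - y a (Suc b))) = t"
    using sum_exchange[OF SP c R] t by (simp add: x_def y_def)
  have u_eq: "u a b = 1 + c * (x a b - x (Suc a) b) - of_bool (\<Pi> a > \<Pi> (Suc a))"
    and v_eq: "v a b = 1 + c * (y a b - y a (Suc b)) - of_bool (R b > R (Suc b))" for a b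
    by (simp_all add: u_def v_def)
  note sums = sum_two_way[OF cc d e bdry xy, of u v, OF _ _ _ _ u_eq v_eq]
  let ?G = "grid_points n" and ?U = "\<lambda>p. fst (T p)" and ?V = "\<lambda>p. snd (T p)"
  have T01: "?U p = 0 \<or> ?U p = 1" "?V p = 0 \<or> ?V p = 1" if "p \<in> ?G" for p
  proof -
    from that obtain a b where "p = (Suc a, Suc b)" "a \<le> n" "b \<le> n"
      by (cases p; cases "fst p"; cases "snd p") (auto simp: grid_points_def)
    then show "?U p = 0 \<or> ?U p = 1" "?V p = 0 \<or> ?V p = 1" using T u01 v01 by simp_all
  qed
  have "finite ?G" by (simp add: grid_points_def)
  note counts = card_by_types[where U = ?U and V = ?V, OF this T01]
  have sum_T: "(\<Sum>p\<in>?G. F (T p)) = (\<Sum>a<n + 1. \<Sum>b<n + 1. F (u a b, v a b))"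
    for F :: "int \<times> int \<Rightarrow> int"
    unfolding sum_grid_points by (intro sum.cong refl) (simp add: T)
  have S: "sum ?U ?G = (N + 1) * (N + 1 - \<beta> - d)" "sum ?V ?G = (N + 1) * (N + 1 - \<beta> - e)"
    "(\<Sum>p\<in>?G. ?U p * ?V p) = q"
    using sums sum_T[of fst] sum_T[of snd] sum_T[of "\<lambda>(U, V). U * V"]
    by (simp_all add: N_def q_def add.commute case_prod_beta del: sum.lessThan_Suc)
  have card: "int (card ?G) = (N + 1) * (N + 1)"
    by (simp add: grid_points_def N_def algebra_simps)
  show "int (card {p \<in> ?G. T p = (1, 1)}) = q"
    and "int (card {p \<in> ?G. T p = (1, 0)}) = (N + 1) * (N + 1 - \<beta> - d) - q"
    and "int (card {p \<in> ?G. T p = (0, 1)}) = (N + 1) * (N + 1 - \<beta> - e) - q"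
    and "int (card {p \<in> ?G. T p = (0, 0)}) =
      (N + 1) * (N + 1) - (N + 1) * (N + 1 - \<beta> - d) - (N + 1) * (N + 1 - \<beta> - e) + q"
    using counts unfolding S card prod.collapse by simp_all
qed

theorem theorem3p14:
  fixes n :: nat and \<pi> :: "nat \<Rightarrow> int" and d e m N :: int
  assumes "\<pi> \<in> signed_perms n"
    and "d = int (desB n \<pi>)"
    and "e = int (idesB n \<pi>)"
    and "m = int (neg_count n \<pi>)"
    and "N = int n"
  shows
    "int (card {p \<in> grid_points n. d_plus n \<pi> p = (0, 0)}) = (d + 1) * (e + 1) - m + N \<and>
     int (card {p \<in> grid_points n. d_plus n \<pi> p = (1, 0)}) = (e + 1) * (N - d) + m - N \<and>
     int (card {p \<in> grid_points n. d_plus n \<pi> p = (0, 1)}) = (d + 1) * (N - e) + m - N \<and>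
     int (card {p \<in> grid_points n. d_plus n \<pi> p = (1, 1)}) = (N - d) * (N - e) - m + N \<and>
     int (card {p \<in> grid_points n. d_minus n \<pi> p = (0, 0)}) = d * e + m \<and>
     int (card {p \<in> grid_points n. d_minus n \<pi> p = (1, 0)}) = e * (N - d + 1) - m \<and>
     int (card {p \<in> grid_points n. d_minus n \<pi> p = (0, 1)}) = d * (N - e + 1) - m \<and>
     int (card {p \<in> grid_points n. d_minus n \<pi> p = (1, 1)}) = (N - d + 1) * (N - e + 1) + m"
proof -
  have "d_plus n \<pi> = (\<lambda>p. (int (desB (n + 1) (insert_entry 1 p \<pi>)) - int (desB n \<pi>),
      int (idesB (n + 1) (insert_entry 1 p \<pi>)) - int (idesB n \<pi>)))"
    and "d_minus n \<pi> = (\<lambda>p. (int (desB (n + 1) (insert_entry (- 1) p \<pi>)) - int (desB n \<pi>),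
      int (idesB (n + 1) (insert_entry (- 1) p \<pi>)) - int (idesB n \<pi>)))"
    by (simp_all add: fun_eq_iff d_plus_def d_minus_def phi_eq_insert_entry phi_bar_eq_insert_entry)
  \<comment> \<open>For \<open>c = 1\<close>, \<open>q\<close> simplifies to
    \<open>(N - d) * (N - e) - m + N\<close>; for \<open>c = - 1\<close> it is
    \<open>(N - d + 1) * (N - e + 1) + m\<close>.\<close>
  then show ?thesis
    using insert_entry_type_counts[OF assms(1) _ assms(2-5) _ refl refl refl, of 1 "d_plus n \<pi>"]
      insert_entry_type_counts[OF assms(1) _ assms(2-5) _ refl refl refl, of "- 1" "d_minus n \<pi>"]
    by (simp add: algebra_simps)
qed

end
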